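(* Let $T$ be a (finite) tree. Then $D(T)=D_{\ell}(T)$.
   Context: A coloring of a graph $G$ is a map $\phi:V(G)\to\mathbb{N}$; a $k$-coloring maps into $[k]=\{1,\dots,k\}$. A coloring is distinguishing if no nontrivial automorphism of $G$ preserves all vertex colors (i.e. there is no nonidentity automorphism $\sigma$ with $\phi(\sigma(v))=\phi(v)$ for all $v$). The distinguishing number $D(G)$ is the minimum number of colors in a distinguishing coloring of $G$. Given a list assignment $L=\{L(v)\}_{v\in V(G)}$, $G$ is $L$-distinguishable if there is a distinguishing coloring $f$ with $f(v)\in L(v)$ for all $v$. The list distinguishing number $D_\ell(G)$ is the minimum integer $k$ such that $G$ is $L$-distinguishable for every list assignment $L$ with $|L(v)|=k$ for all $v$. *)

theory Defs
  imports "Graph_Theory.Digraph_Component" "HOL-Combinatorics.Permutations"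
begin

text \<open>
  Finite simple graphs are the library's \<^locale>\<open>pair_graph\<close>: a finite vertex set with a finite,
  symmetric, loop-free set of arcs, an undirected edge being a pair of opposite arcs.  The library's
  \<^const>\<open>Digraph_Component.tree\<close> is not the right notion for such graphs, because the two arcs
  of an edge already form a directed cycle of length 2; hence only cycles of length at least 3
  count as cycles of the undirected graph.  Connectedness includes that there is a vertex.
\<close>

definition undirected_tree :: "'a pair_pre_digraph \<Rightarrow> bool" where
  "undirected_tree G \<longleftrightarrow> pair_graph G \<and> Digraph_Component.connected (with_proj G) \<and>
     \<not> (\<exists>p. pre_digraph.cycle (with_proj G) p \<and> 3 \<le> length p)"

text \<open>Automorphisms are extended by the identity outside the vertex set.\<close>

definition graph_automorphism :: "'a pair_pre_digraph \<Rightarrow> ('a \<Rightarrow> 'a) \<Rightarrow> bool" where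
  "graph_automorphism G \<sigma> \<longleftrightarrow> \<sigma> permutes pverts G \<and>
     (\<forall>u\<in>pverts G. \<forall>v\<in>pverts G. (\<sigma> u, \<sigma> v) \<in> parcs G \<longleftrightarrow> (u, v) \<in> parcs G)"

definition distinguishing :: "'a pair_pre_digraph \<Rightarrow> ('a \<Rightarrow> nat) \<Rightarrow> bool" where
  "distinguishing G \<phi> \<longleftrightarrow>
     \<not> (\<exists>\<sigma>. graph_automorphism G \<sigma> \<and> \<sigma> \<noteq> id \<and> (\<forall>v\<in>pverts G. \<phi> (\<sigma> v) = \<phi> v))"

definition k_coloring :: "'a pair_pre_digraph \<Rightarrow> nat \<Rightarrow> ('a \<Rightarrow> nat) \<Rightarrow> bool" where
  "k_coloring G k \<phi> \<longleftrightarrow> (\<forall>v\<in>pverts G. \<phi> v \<in> {1..k})"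

definition distinguishing_number :: "'a pair_pre_digraph \<Rightarrow> nat" where
  "distinguishing_number G = (LEAST k. \<exists>\<phi>. k_coloring G k \<phi> \<and> distinguishing G \<phi>)"

definition list_distinguishable :: "'a pair_pre_digraph \<Rightarrow> ('a \<Rightarrow> nat set) \<Rightarrow> bool" where
  "list_distinguishable G L \<longleftrightarrow> (\<exists>f. distinguishing G f \<and> (\<forall>v\<in>pverts G. f v \<in> L v))"

definition list_distinguishing_number :: "'a pair_pre_digraph \<Rightarrow> nat" where
  "list_distinguishing_number G =
     (LEAST k. \<forall>L. (\<forall>v\<in>pverts G. finite (L v) \<and> card (L v) = k) \<longrightarrow> list_distinguishable G L)"

text \<open>
  Both minima are attained on finite graphs, and the first one is also the least number of
  colors actually used by a distinguishing coloring.
\<close>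

lemma inj_on_imp_distinguishing:
  assumes "inj_on \<phi> (pverts G)"
  shows "distinguishing G \<phi>"
proof -
  have "\<sigma> = id" if "\<sigma> permutes pverts G" "\<forall>v\<in>pverts G. \<phi> (\<sigma> v) = \<phi> v" for \<sigma>
  proof
    fix v show "\<sigma> v = id v"
    proof (cases "v \<in> pverts G")
      case True
      then have "\<sigma> v \<in> pverts G" using that(1) by (simp add: permutes_in_image)
      then show ?thesis using inj_onD[OF assms, of "\<sigma> v" v] True that(2) by simp
    next
      case False
      then show ?thesis using that(1) by (simp add: permutes_not_in)
    qed
  qed
  then show ?thesis by (auto simp: distinguishing_def graph_automorphism_def)
qed

lemma distinguishing_inj_comp:
  assumes "distinguishing G \<phi>" "inj_on h (\<phi> ` pverts G)"
  shows "distinguishing G (h \<circ> \<phi>)"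
  unfolding distinguishing_def
proof (rule notI, elim exE conjE)
  fix \<sigma> assume a: "graph_automorphism G \<sigma>" "\<sigma> \<noteq> id" "\<forall>v\<in>pverts G. (h \<circ> \<phi>) (\<sigma> v) = (h \<circ> \<phi>) v"
  have "\<phi> (\<sigma> v) = \<phi> v" if "v \<in> pverts G" for v
  proof -
    have "\<sigma> v \<in> pverts G" using a(1) that by (simp add: graph_automorphism_def permutes_in_image)
    then show ?thesis using inj_onD[OF assms(2), of "\<phi> (\<sigma> v)" "\<phi> v"] a(3) that by simp
  qed
  then show False using a(1,2) assms(1) by (auto simp: distinguishing_def)
qed

lemma distinguishing_recolor:
  assumes "finite (pverts G)" "distinguishing G \<phi>"
  shows "\<exists>\<psi>. k_coloring G (card (\<phi> ` pverts G)) \<psi> \<and> distinguishing G \<psi>"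
proof -
  obtain h where h: "bij_betw h (\<phi> ` pverts G) {1..card (\<phi> ` pverts G)}"
    using assms(1) finite_same_card_bij[of "\<phi> ` pverts G" "{1..card (\<phi> ` pverts G)}"] by auto
  then have "distinguishing G (h \<circ> \<phi>)"
    using distinguishing_inj_comp[OF assms(2)] by (simp add: bij_betw_def)
  moreover have "k_coloring G (card (\<phi> ` pverts G)) (h \<circ> \<phi>)"
    unfolding k_coloring_def using bij_betwE[OF h] by simp
  ultimately show ?thesis by blast
qed

lemma distinguishing_number_attained:
  assumes "finite (pverts G)"
  shows "\<exists>\<phi>. k_coloring G (distinguishing_number G) \<phi> \<and> distinguishing G \<phi>"
proof -
  obtain h :: "'a \<Rightarrow> nat" where "inj_on h (pverts G)"
    using finite_imp_inj_to_nat_seg[OF assms] by auto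
  from distinguishing_recolor[OF assms inj_on_imp_distinguishing[OF this]]
  have "\<exists>k \<phi>. k_coloring G k \<phi> \<and> distinguishing G \<phi>" by (rule exI)
  then show ?thesis unfolding distinguishing_number_def by (rule LeastI_ex)
qed

lemma distinguishing_number_altdef:
  assumes "finite (pverts G)"
  shows "distinguishing_number G = (LEAST k. \<exists>\<phi>. distinguishing G \<phi> \<and> card (\<phi> ` pverts G) = k)"
proof (rule Least_equality[symmetric])
  have least: "distinguishing_number G \<le> card (\<phi> ` pverts G)" if "distinguishing G \<phi>" for \<phi>
    unfolding distinguishing_number_def
    by (rule Least_le) (rule distinguishing_recolor[OF assms that])
  obtain \<phi> where \<phi>: "k_coloring G (distinguishing_number G) \<phi>" "distinguishing G \<phi>"
    using distinguishing_number_attained[OF assms] by blast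
  have "card (\<phi> ` pverts G) \<le> card {1..distinguishing_number G}"
    using \<phi>(1) by (intro card_mono) (auto simp: k_coloring_def)
  with least[OF \<phi>(2)] \<phi>(2)
  show "\<exists>\<phi>. distinguishing G \<phi> \<and> card (\<phi> ` pverts G) = distinguishing_number G" by auto
  show "distinguishing_number G \<le> k" if "\<exists>\<phi>. distinguishing G \<phi> \<and> card (\<phi> ` pverts G) = k" for k
    using that least by blast
qed

lemma inj_choice_from_lists:
  assumes "finite A" "\<forall>v\<in>A. finite (L v) \<and> card A \<le> card (L v)"
  shows "\<exists>f. inj_on f A \<and> (\<forall>v\<in>A. f v \<in> L v)"
  using assms
proof (induction A rule: finite_induct)
  case (insert a A)
  have "\<forall>v\<in>A. finite (L v) \<and> card A \<le> card (L v)"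
    using insert.prems insert.hyps by (simp add: Suc_le_eq less_imp_le)
  then obtain f where f: "inj_on f A" "\<forall>v\<in>A. f v \<in> L v" using insert.IH by blast
  have "card A < card (L a)" using insert.prems insert.hyps by simp
  then have "card (f ` A) < card (L a)" using card_image_le[OF insert.hyps(1), of f] by linarith
  then have "\<not> L a \<subseteq> f ` A"
    using card_mono[of "f ` A" "L a"] insert(1) by auto
  then obtain c where c: "c \<in> L a" "c \<notin> f ` A" by blast
  have "inj_on (f(a := c)) (insert a A)"
    using f(1) c(2) insert(2) by (auto simp: inj_on_def)
  moreover have "\<forall>v\<in>insert a A. (f(a := c)) v \<in> L v" using f(2) c(1) by auto
  ultimately show ?case by blast
qed simp

lemma list_distinguishing_number_attained:
  assumes "finite (pverts G)"
    and "\<forall>v\<in>pverts G. finite (L v) \<and> card (L v) = list_distinguishing_number G"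
  shows "list_distinguishable G L"
proof -
  have "\<forall>L. (\<forall>v\<in>pverts G. finite (L v) \<and> card (L v) = card (pverts G)) \<longrightarrow> list_distinguishable G L"
  proof (intro allI impI)
    fix L :: "'a \<Rightarrow> nat set"
    assume "\<forall>v\<in>pverts G. finite (L v) \<and> card (L v) = card (pverts G)"
    then obtain f where "inj_on f (pverts G)" "\<forall>v\<in>pverts G. f v \<in> L v"
      using inj_choice_from_lists[OF assms(1), of L] by auto
    then show "list_distinguishable G L"
      using inj_on_imp_distinguishing unfolding list_distinguishable_def by blast
  qed
  then have "\<forall>L. (\<forall>v\<in>pverts G. finite (L v) \<and> card (L v) = list_distinguishing_number G)
               \<longrightarrow> list_distinguishable G L"
    unfolding list_distinguishing_number_def by (rule LeastI)
  then show ?thesis using assms(2) by blast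
qed

end

theory Submission
  imports Defs "HOL-Library.Nat_Bijection"
begin

text \<open>
  Remove all leaves of the tree at once, recording at each remaining vertex its own color
  together with the set of colors of the leaves attached to it.  A coloring is distinguishing
  iff leaves with a common neighbour get distinct colors and the recorded coloring of the smaller
  tree is distinguishing.  The possible records at a vertex form a new list, so the induction
  compares two list assignments: one, \<open>K\<close>, in which any two lists are equal or disjoint (at the
  start, all of them are \<open>{1..k}\<close>), and an arbitrary one, \<open>L\<close>, whose lists are at least as
  large and are disjoint wherever those of \<open>K\<close> are.  These hypotheses survive the removal of the
  leaves because \<open>L\<close> has at least as many transversals as \<open>K\<close> on each set of leaves with a
  common neighbour.  The process ends with at most two vertices, where distinguishing means injective.
\<close>

section \<open>Counting transversals\<close>

text \<open>Color sets and not choice functions are counted, because leaves with a common neighbour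
  are interchangeable: up to automorphism only the set of their colors matters.\<close>

definition transversals :: "'i set \<Rightarrow> ('i \<Rightarrow> 'c set) \<Rightarrow> 'c set set" where
  "transversals I F = {f ` I | f. inj_on f I \<and> (\<forall>i\<in>I. f i \<in> F i)}"

lemma transversalsI: "inj_on f I \<Longrightarrow> \<forall>i\<in>I. f i \<in> F i \<Longrightarrow> f ` I \<in> transversals I F"
  unfolding transversals_def by blast

lemma transversalsE:
  assumes "X \<in> transversals I F"
  obtains f where "X = f ` I" "inj_on f I" "\<forall>i\<in>I. f i \<in> F i"
  using assms unfolding transversals_def by blast

lemma finite_transversals:
  assumes "finite I" "\<forall>i\<in>I. finite (F i)"
  shows "finite (transversals I F)"
proof (rule finite_subset)
  show "transversals I F \<subseteq> Pow (\<Union>i\<in>I. F i)" by (auto elim!: transversalsE)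
  show "finite (Pow (\<Union>i\<in>I. F i))" using assms by simp
qed

lemma finite_transversal: "finite I \<Longrightarrow> X \<in> transversals I F \<Longrightarrow> finite X"
  by (auto elim: transversalsE)

definition uniform_lists :: "'i set \<Rightarrow> ('i \<Rightarrow> 'c set) \<Rightarrow> ('i \<Rightarrow> 'c set) \<Rightarrow> bool" where
  "uniform_lists I A F \<longleftrightarrow> (\<forall>i\<in>I. finite (A i) \<and> finite (F i) \<and> card (A i) \<le> card (F i)) \<and>
     (\<forall>i\<in>I. \<forall>j\<in>I. A i = A j \<or> A i \<inter> A j = {} \<and> F i \<inter> F j = {})"

lemma uniform_lists_subset: "uniform_lists I A F \<Longrightarrow> J \<subseteq> I \<Longrightarrow> uniform_lists J A F"
  unfolding uniform_lists_def by blast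

text \<open>A list \<open>F j\<close> can lose \<open>x\<close> only if \<open>A j = A i\<close>,
  and then \<open>A j\<close> loses \<open>a\<close> as well; otherwise the lists at
  \<open>j\<close> are disjoint from those at \<open>i\<close> and stay unchanged.\<close>

lemma uniform_lists_remove:
  assumes u: "uniform_lists I A F" and i: "i \<in> I" "a \<in> A i" "x \<in> F i"
  shows "uniform_lists I (\<lambda>j. A j - {a}) (\<lambda>j. F j - {x})"
  unfolding uniform_lists_def
proof (intro conjI ballI)
  fix j assume j: "j \<in> I"
  show "finite (A j - {a})" "finite (F j - {x})" using u j unfolding uniform_lists_def by auto
  show "card (A j - {a}) \<le> card (F j - {x})"
  proof (cases "A i = A j")
    case True
    then have "card (A j - {a}) = card (A j) - 1" using i by simp
    also have "\<dots> \<le> card (F j) - 1" using u j unfolding uniform_lists_def by (simp add: diff_le_mono)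
    also have "\<dots> \<le> card (F j - {x})" using diff_card_le_card_Diff[of "{x}" "F j"] by simp
    finally show ?thesis .
  next
    case False
    then have "A i \<inter> A j = {}" "F i \<inter> F j = {}" using u i j unfolding uniform_lists_def by blast+
    then have "A j - {a} = A j" "F j - {x} = F j" using i by auto
    then show ?thesis using u j unfolding uniform_lists_def by simp
  qed
next
  fix j k assume "j \<in> I" "k \<in> I"
  then have "A j = A k \<or> A j \<inter> A k = {} \<and> F j \<inter> F k = {}"
    using u unfolding uniform_lists_def by blast
  then show "A j - {a} = A k - {a} \<or>
    (A j - {a}) \<inter> (A k - {a}) = {} \<and> (F j - {x}) \<inter> (F k - {x}) = {}" by blast
qed

text \<open>
  Both sides are split by Pascal's rule: a transversal contains a fixed element of the list of
  \<open>i\<close> or it does not.  On the uniform side an element of the transversal lying in the list of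
  \<open>i\<close> can always be made to represent \<open>i\<close>, so that the split loses nothing there.
\<close>

lemma card_transversals_le:
  assumes "finite I" "uniform_lists I A F"
  shows "card (transversals I A) \<le> card (transversals I F)"
  using assms
\<comment> \<open>Both branches of the split delete \<open>a\<close> from all lists, so the union of
  the lists shrinks even where the index set stays \<open>I\<close>.\<close>
proof (induction "card (\<Union>i\<in>I. A i)" arbitrary: I A F rule: less_induct)
  case less
  note finI = less.prems(1) and u = less.prems(2)
  have finA: "\<forall>i\<in>I. finite (A i)" and finF: "\<forall>i\<in>I. finite (F i)"
    using u unfolding uniform_lists_def by auto
  consider "I = {}" | i where "i \<in> I" "A i = {}" | i a where "i \<in> I" "a \<in> A i" by blast
  then show ?case
  proof cases
    case 1
    then show ?thesis unfolding transversals_def by simp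
  next
    case 2
    then have "transversals I A = {}" by (auto elim!: transversalsE)
    then show ?thesis by simp
  next
    case (3 i a)
    have "0 < card (A i)" using 3 finA card_gt_0_iff by blast
    then have "0 < card (F i)" using u 3 unfolding uniform_lists_def by (meson less_le_trans)
    then obtain x where x: "x \<in> F i" by (metis card_gt_0_iff ex_in_conv)
    define A' F' where "A' = (\<lambda>j. A j - {a})" and "F' = (\<lambda>j. F j - {x})"
    have u': "uniform_lists I A' F'"
      unfolding A'_def F'_def using uniform_lists_remove[OF u 3 x] .
    have finF': "\<forall>i\<in>I. finite (F' i)" using u' unfolding uniform_lists_def by auto
    have finA': "\<forall>i\<in>I. finite (A' i)" using u' unfolding uniform_lists_def by auto
    have smaller: "card (\<Union>j\<in>J. A' j) < card (\<Union>j\<in>I. A j)" if "J \<subseteq> I" for J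
    proof (rule psubset_card_mono)
      show "finite (\<Union>j\<in>I. A j)" using finI finA by simp
      have "a \<in> (\<Union>j\<in>I. A j)" "a \<notin> (\<Union>j\<in>J. A' j)" using 3 by (auto simp: A'_def)
      moreover have "(\<Union>j\<in>J. A' j) \<subseteq> (\<Union>j\<in>I. A j)" using that by (auto simp: A'_def)
      ultimately show "(\<Union>j\<in>J. A' j) \<subset> (\<Union>j\<in>I. A j)" by blast
    qed
    have IH: "card (transversals J A') \<le> card (transversals J F')" if "J \<subseteq> I" for J
      using less.hyps[OF smaller[OF that]] finite_subset[OF that finI] uniform_lists_subset[OF u' that]
      by blast
    let ?J = "I - {i}"
    have sub: "transversals I A \<subseteq> insert a ` transversals ?J A' \<union> transversals I A'"
    proof
      fix X assume "X \<in> transversals I A"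
      then obtain f where f: "X = f ` I" "inj_on f I" "\<forall>i\<in>I. f i \<in> A i" by (rule transversalsE)
      show "X \<in> insert a ` transversals ?J A' \<union> transversals I A'"
      proof (cases "a \<in> X")
        case False
        then have "X \<in> transversals I A'"
          unfolding f(1) using f by (intro transversalsI) (auto simp: A'_def)
        then show ?thesis by blast
      next
        case True
        then obtain j where j: "j \<in> I" "a = f j" using f(1) by blast
        then have "A j \<inter> A i \<noteq> {}" using f 3 by blast
        then have Aj: "A j = A i" using u j 3 unfolding uniform_lists_def by blast
        define g where "g = f(j := f i)"
        have img: "g ` ?J = X - {a}"
          using j 3 f(2) unfolding f(1) g_def by (auto simp: inj_on_def)
        have "inj_on g ?J" using f(2) j 3 unfolding g_def inj_on_def by auto
        moreover have "\<forall>k\<in>?J. g k \<in> A' k"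
          using f j 3 Aj unfolding g_def A'_def by (auto simp: inj_on_def)
        ultimately have "g ` ?J \<in> transversals ?J A'" by (rule transversalsI)
        moreover have "X = insert a (g ` ?J)" using True img by auto
        ultimately show ?thesis by blast
      qed
    qed
    have sup: "insert x ` transversals ?J F' \<union> transversals I F' \<subseteq> transversals I F"
    proof
      fix X assume "X \<in> insert x ` transversals ?J F' \<union> transversals I F'"
      then consider Y where "X = insert x Y" "Y \<in> transversals ?J F'" | "X \<in> transversals I F'"
        by blast
      then show "X \<in> transversals I F"
      proof cases
        case 1
        then obtain f where f: "Y = f ` ?J" "inj_on f ?J" "\<forall>k\<in>?J. f k \<in> F' k"
          by (elim transversalsE)
        have "X = (f(i := x)) ` I" using 1 f(1) 3 by auto
        moreover have "inj_on (f(i := x)) I" using f(2,3) unfolding inj_on_def F'_def by auto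
        moreover have "\<forall>k\<in>I. (f(i := x)) k \<in> F k" using f(3) x unfolding F'_def by auto
        ultimately show ?thesis using transversalsI by metis
      next
        case 2
        then show ?thesis unfolding transversals_def F'_def by blast
      qed
    qed
    \<comment> \<open>Omitting \<open>x\<close> makes \<open>insert x\<close> injective on these
      transversals and separates the two families, so cardinalities add up exactly on the
      \<open>F\<close> side; on the \<open>A\<close> side the union bound suffices.\<close>
    have nx: "x \<notin> Y" if "Y \<in> transversals J F'" for Y J
      using that by (auto simp: F'_def elim!: transversalsE)
    have finJ: "finite (transversals ?J F')" and finT: "finite (transversals I F')"
      using finI finF' by (auto intro!: finite_transversals)
    have finJA: "finite (transversals ?J A')" and finTA: "finite (transversals I A')"
      using finI finA' by (auto intro!: finite_transversals)
    have "card (transversals I A) \<le> card (insert a ` transversals ?J A' \<union> transversals I A')"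
      using finJA finTA by (intro card_mono sub) auto
    also have "\<dots> \<le> card (transversals ?J A') + card (transversals I A')"
      using card_Un_le card_image_le[OF finJA] by (meson add_le_mono1 le_trans)
    also have "\<dots> \<le> card (transversals ?J F') + card (transversals I F')"
      using IH by (intro add_mono) auto
    also have "\<dots> = card (insert x ` transversals ?J F') + card (transversals I F')"
    proof -
      have "inj_on (insert x) (transversals ?J F')"
        using nx by (intro inj_onI) (metis insert_ident)
      then show ?thesis by (simp add: card_image)
    qed
    also have "\<dots> = card (insert x ` transversals ?J F' \<union> transversals I F')"
      using finJ finT nx by (intro card_Un_disjoint[symmetric]) auto
    also have "\<dots> \<le> card (transversals I F)"
      using finI finF by (intro card_mono sup finite_transversals) auto
    finally show ?thesis .
  qed
qed

section \<open>Removing all leaves of a graph\<close>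

text \<open>\<open>E\<close> is kept when vertices are removed and may then contain arcs that leave
  \<open>V\<close>; automorphisms, and \<open>neighbours\<close> of a vertex of \<open>V\<close>,
  depend only on the arcs inside \<open>V\<close>.\<close>

abbreviation graph_on :: "'a set \<Rightarrow> 'a rel \<Rightarrow> 'a pair_pre_digraph" where
  "graph_on V E \<equiv> \<lparr>pverts = V, parcs = E\<rparr>"

definition neighbours :: "'a rel \<Rightarrow> 'a set \<Rightarrow> 'a \<Rightarrow> 'a set" where
  "neighbours E V v = {u \<in> V. (v, u) \<in> E}"

definition leaves :: "'a rel \<Rightarrow> 'a set \<Rightarrow> 'a set" where
  "leaves E V = {v \<in> V. card (neighbours E V v) = 1}"

definition pendants :: "'a rel \<Rightarrow> 'a set \<Rightarrow> 'a \<Rightarrow> 'a set" where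
  "pendants E V v = neighbours E V v \<inter> leaves E V"

text \<open>Packing a record into one natural number makes the recorded coloring a
  \<open>nat\<close>-valued coloring again, so the removal of leaves can be iterated.\<close>

definition code :: "nat \<Rightarrow> nat set \<Rightarrow> nat" where
  "code c X = prod_encode (c, set_encode X)"

lemma code_inject:
  assumes "finite X" "finite Y"
  shows "code c X = code d Y \<longleftrightarrow> c = d \<and> X = Y"
  using assms by (auto simp: code_def set_encode_eq)

definition absorbed_coloring :: "'a rel \<Rightarrow> 'a set \<Rightarrow> ('a \<Rightarrow> nat) \<Rightarrow> 'a \<Rightarrow> nat" where
  "absorbed_coloring E V \<phi> v = code (\<phi> v) (\<phi> ` pendants E V v)"

lemma distinguishing_graph_on:
  "distinguishing (graph_on V E) \<phi> \<longleftrightarrow>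
     (\<forall>\<sigma>. \<sigma> permutes V \<longrightarrow> (\<forall>u\<in>V. \<forall>v\<in>V. (\<sigma> u, \<sigma> v) \<in> E \<longleftrightarrow> (u, v) \<in> E) \<longrightarrow>
        (\<forall>v\<in>V. \<phi> (\<sigma> v) = \<phi> v) \<longrightarrow> \<sigma> = id)"
  unfolding distinguishing_def graph_automorphism_def by auto

lemma distinguishing_cong:
  assumes "\<And>v. v \<in> V \<Longrightarrow> \<phi> v = \<psi> v"
  shows "distinguishing (graph_on V E) \<phi> \<longleftrightarrow> distinguishing (graph_on V E) \<psi>"
proof -
  have "(\<forall>v\<in>V. \<phi> (\<sigma> v) = \<phi> v) \<longleftrightarrow> (\<forall>v\<in>V. \<psi> (\<sigma> v) = \<psi> v)" if "\<sigma> permutes V" for \<sigma>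
    using that assms by (auto simp: permutes_in_image)
  then show ?thesis unfolding distinguishing_graph_on by blast
qed

text \<open>The transposition of two twins of equal color is a color-preserving automorphism, also
  when they are adjacent. This serves for leaves with a common neighbour and for graphs with just
  two vertices.\<close>

lemma distinguishing_transpose:
  assumes "distinguishing (graph_on V E) \<phi>" "sym E" "irrefl E" "a \<in> V" "b \<in> V" "\<phi> a = \<phi> b"
    and twins: "\<And>w. w \<in> V - {a, b} \<Longrightarrow> (a, w) \<in> E \<longleftrightarrow> (b, w) \<in> E"
  shows "a = b"
proof -
  have s: "(x, y) \<in> E \<longleftrightarrow> (y, x) \<in> E" for x y using \<open>sym E\<close> by (auto dest: symD)
  have i: "(x, x) \<notin> E" for x using \<open>irrefl E\<close> by (auto simp: irrefl_def)
  have twins': "(w, a) \<in> E \<longleftrightarrow> (w, b) \<in> E" if "w \<in> V - {a, b}" for w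
    using twins[OF that] s by metis
  have "transpose a b permutes V" using assms by (simp add: permutes_swap_id)
  moreover have "(transpose a b u, transpose a b v) \<in> E \<longleftrightarrow> (u, v) \<in> E" if "u \<in> V" "v \<in> V" for u v
  proof (cases "u \<in> {a, b}")
    case u: True
    show ?thesis
    proof (cases "v \<in> {a, b}")
      case True
      then show ?thesis using u s i
        by (metis insertE singletonD transpose_apply_first transpose_apply_second)
    next
      case False
      then show ?thesis using u twins[of v] that by auto
    qed
  next
    case u: False
    then have "transpose a b u = u" by simp
    moreover have "(u, transpose a b v) \<in> E \<longleftrightarrow> (u, v) \<in> E"
      using twins'[of u] u that by (cases "v = a"; cases "v = b") auto
    ultimately show ?thesis by simp
  qed
  moreover have "\<phi> (transpose a b v) = \<phi> v" for v using assms(6) by (simp add: transpose_def)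
  ultimately have "transpose a b = id" using assms(1) unfolding distinguishing_graph_on by blast
  then show ?thesis by (metis id_apply transpose_apply_first)
qed

text \<open>No leaf hangs at another leaf, as would happen in a single edge. All leaves can
  therefore be removed at once, each leaving its trace at a remaining vertex.\<close>

locale leafy_graph =
  fixes V :: "'a set" and E :: "'a rel"
  assumes finite_V: "finite V" and sym_E: "sym E" and irrefl_E: "irrefl E"
    and leaf_neighbour: "\<And>u. u \<in> leaves E V \<Longrightarrow> \<exists>p\<in>V - leaves E V. neighbours E V u = {p}"
begin

abbreviation "core \<equiv> V - leaves E V"
abbreviation "pend \<equiv> pendants E V"

definition parent :: "'a \<Rightarrow> 'a" where
  "parent u = (THE p. neighbours E V u = {p})"

lemma parent:
  assumes "u \<in> leaves E V"
  shows "parent u \<in> core" "neighbours E V u = {parent u}"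
proof -
  obtain p where p: "p \<in> core" "neighbours E V u = {p}" using leaf_neighbour[OF assms] by blast
  then have "parent u = p" unfolding parent_def by auto
  then show "parent u \<in> core" "neighbours E V u = {parent u}" using p by auto
qed

lemma edge_commute: "(u, v) \<in> E \<longleftrightarrow> (v, u) \<in> E"
  using sym_E by (auto dest: symD)

lemma leaves_subset: "leaves E V \<subseteq> V"
  by (auto simp: leaves_def)

lemma edge_leaf_iff:
  assumes "u \<in> leaves E V" "v \<in> V"
  shows "(u, v) \<in> E \<longleftrightarrow> v = parent u"
  using parent(2)[OF assms(1)] assms(2) unfolding neighbours_def by blast

lemma pend_iff: "v \<in> V \<Longrightarrow> u \<in> pend v \<longleftrightarrow> u \<in> leaves E V \<and> parent u = v"
  using edge_leaf_iff[of u v] leaves_subset edge_commute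
  by (auto simp: pendants_def neighbours_def)

lemma finite_pend: "finite (pend v)"
  using finite_V by (auto simp: pendants_def neighbours_def)

lemma pend_subset: "pend v \<subseteq> V"
  by (auto simp: pendants_def neighbours_def)

section \<open>Distinguishing colorings of the graph and of its core\<close>

lemma inj_on_pend_if_distinguishing:
  assumes "distinguishing (graph_on V E) \<phi>" "v \<in> core"
  shows "inj_on \<phi> (pend v)"
proof (rule inj_onI)
  fix a b assume ab: "a \<in> pend v" "b \<in> pend v" "\<phi> a = \<phi> b"
  then have l: "a \<in> leaves E V" "b \<in> leaves E V" "parent a = v" "parent b = v"
    using pend_iff[of v] assms(2) by auto
  show "a = b"
    using ab(3) l leaves_subset
    by (intro distinguishing_transpose[OF assms(1) sym_E irrefl_E]) (auto simp: edge_leaf_iff)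
qed

text \<open>A record-preserving automorphism \<open>\<sigma>\<close> of the core extends to the
  leaves: \<open>p\<close> and \<open>\<sigma> p\<close> carry leaves of the same colors, so each
  leaf at \<open>p\<close> can go to a leaf of its color at \<open>\<sigma> p\<close>. The extension
  \<open>\<tau>\<close> preserves colors and must be the identity.\<close>

lemma distinguishing_absorbed:
  assumes dist: "distinguishing (graph_on V E) \<phi>"
  shows "distinguishing (graph_on core E) (absorbed_coloring E V \<phi>)"
  unfolding distinguishing_graph_on
proof (intro allI impI)
  fix \<sigma> assume perm: "\<sigma> permutes core"
    and edge: "\<forall>u\<in>core. \<forall>v\<in>core. (\<sigma> u, \<sigma> v) \<in> E \<longleftrightarrow> (u, v) \<in> E"
    and col: "\<forall>v\<in>core. absorbed_coloring E V \<phi> (\<sigma> v) = absorbed_coloring E V \<phi> v"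
  have core_iff: "\<sigma> v \<in> core \<longleftrightarrow> v \<in> core" for v using perm by (rule permutes_in_image)
  have col1: "\<phi> (\<sigma> v) = \<phi> v" and col2: "\<phi> ` pend (\<sigma> v) = \<phi> ` pend v" if "v \<in> core" for v
    using col that finite_pend by (auto simp: absorbed_coloring_def code_inject)
  have "\<exists>w. w \<in> pend (\<sigma> (parent u)) \<and> \<phi> w = \<phi> u" if "u \<in> leaves E V" for u
  proof -
    have "u \<in> pend (parent u)" using that parent(1)[OF that] pend_iff by auto
    then have "\<phi> u \<in> \<phi> ` pend (\<sigma> (parent u))" using col2[OF parent(1)[OF that]] by blast
    then show ?thesis by (metis image_iff)
  qed
  then obtain m where m: "m u \<in> pend (\<sigma> (parent u))" "\<phi> (m u) = \<phi> u" if "u \<in> leaves E V" for u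
    by metis
  have m_leaf: "m u \<in> leaves E V" and m_parent: "parent (m u) = \<sigma> (parent u)"
    if "u \<in> leaves E V" for u
    using m(1)[OF that] pend_iff core_iff parent(1)[OF that] by auto
  define \<tau> where "\<tau> x = (if x \<in> leaves E V then m x else \<sigma> x)" for x
  have \<tau>_core: "\<tau> x = \<sigma> x" if "x \<in> core" for x using that by (simp add: \<tau>_def)
  have leaf_iff: "\<tau> x \<in> leaves E V \<longleftrightarrow> x \<in> leaves E V" if "x \<in> V" for x
    using that m_leaf core_iff[of x] by (auto simp: \<tau>_def)
  \<comment> \<open>Leaves with the same image have the same parent and the same color, and a
    distinguishing coloring is injective on the leaves at one vertex.\<close>
  have inj: "inj_on \<tau> V"
  proof (rule inj_onI)
    fix x y assume xy: "x \<in> V" "y \<in> V" "\<tau> x = \<tau> y"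
    show "x = y"
    proof (cases "x \<in> leaves E V")
      case True
      then have y: "y \<in> leaves E V" using leaf_iff xy by metis
      have eq: "m x = m y" using xy(3) True y by (simp add: \<tau>_def)
      then have "\<sigma> (parent x) = \<sigma> (parent y)" using m_parent True y by metis
      then have p: "parent x = parent y" using permutes_inj[OF perm] by (simp add: inj_eq)
      have "\<phi> x = \<phi> y" using eq m(2) True y by metis
      moreover have "x \<in> pend (parent x)" "y \<in> pend (parent x)"
        using True y p parent(1)[OF True] pend_iff by auto
      ultimately show ?thesis
        using inj_on_pend_if_distinguishing[OF dist parent(1)[OF True]] by (auto dest: inj_onD)
    next
      case False
      then have "y \<notin> leaves E V" using leaf_iff xy by metis
      then show ?thesis using False xy permutes_inj[OF perm] by (simp add: \<tau>_def inj_eq)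
    qed
  qed
  have "\<tau> ` V \<subseteq> V"
    using m_leaf leaves_subset core_iff by (auto simp: \<tau>_def)
  then have bij: "bij_betw \<tau> V V"
    using inj finite_V by (simp add: bij_betw_def endo_inj_surj)
  have perm\<tau>: "\<tau> permutes V"
  proof (rule bij_imp_permutes[OF bij])
    fix x assume "x \<notin> V"
    then show "\<tau> x = x" using leaves_subset permutes_not_in[OF perm, of x] by (auto simp: \<tau>_def)
  qed
  have \<tau>V: "\<tau> x \<in> V" if "x \<in> V" for x using \<open>\<tau> ` V \<subseteq> V\<close> that by blast
  \<comment> \<open>The only neighbour of a leaf is its parent, and on leaves \<open>\<tau>\<close>
    commutes with \<open>parent\<close>.\<close>
  have leaf_edge: "(\<tau> u, \<tau> v) \<in> E \<longleftrightarrow> (u, v) \<in> E" if "u \<in> leaves E V" "v \<in> V" for u v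
  proof -
    have "u \<in> V" using that leaves_subset by blast
    have "(\<tau> u, \<tau> v) \<in> E \<longleftrightarrow> \<tau> v = parent (\<tau> u)"
      using that \<tau>V leaf_iff[OF \<open>u \<in> V\<close>] by (intro edge_leaf_iff) auto
    also have "parent (\<tau> u) = \<tau> (parent u)"
      using that(1) m_parent parent(1)[OF that(1)] by (simp add: \<tau>_def)
    also have "\<tau> v = \<tau> (parent u) \<longleftrightarrow> v = parent u"
      using inj that(2) parent(1)[OF that(1)] by (auto dest: inj_onD)
    also have "\<dots> \<longleftrightarrow> (u, v) \<in> E" using edge_leaf_iff[OF that] by simp
    finally show ?thesis .
  qed
  have "(\<tau> u, \<tau> v) \<in> E \<longleftrightarrow> (u, v) \<in> E" if "u \<in> V" "v \<in> V" for u v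
  proof (cases "u \<in> leaves E V \<or> v \<in> leaves E V")
    case True
    then show ?thesis using leaf_edge that edge_commute by metis
  next
    case False
    then show ?thesis using edge that by (simp add: \<tau>_def)
  qed
  moreover have "\<phi> (\<tau> v) = \<phi> v" if "v \<in> V" for v
    using that m(2) col1 by (simp add: \<tau>_def)
  ultimately have "\<tau> = id" using dist perm\<tau> unfolding distinguishing_graph_on by blast
  show "\<sigma> = id"
  proof
    fix x show "\<sigma> x = id x"
    proof (cases "x \<in> core")
      case True
      then show ?thesis using \<tau>_core \<open>\<tau> = id\<close> by metis
    next
      case False
      then show ?thesis using permutes_not_in[OF perm] by simp
    qed
  qed
qed

text \<open>A color-preserving automorphism respects leaves and their attachment, so on the core it
  preserves records and is trivial. Every leaf then stays at its parent, where its color identifies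
  it.\<close>

lemma distinguishing_if_absorbed:
  assumes dist: "distinguishing (graph_on core E) (absorbed_coloring E V \<phi>)"
    and inj: "\<And>v. v \<in> core \<Longrightarrow> inj_on \<phi> (pend v)"
  shows "distinguishing (graph_on V E) \<phi>"
  unfolding distinguishing_graph_on
proof (intro allI impI)
  fix \<sigma> assume perm: "\<sigma> permutes V"
    and edge: "\<forall>u\<in>V. \<forall>v\<in>V. (\<sigma> u, \<sigma> v) \<in> E \<longleftrightarrow> (u, v) \<in> E"
    and col: "\<forall>v\<in>V. \<phi> (\<sigma> v) = \<phi> v"
  have V_iff: "\<sigma> v \<in> V \<longleftrightarrow> v \<in> V" for v using perm by (rule permutes_in_image)
  have img: "\<sigma> ` V = V" using perm by (rule permutes_image)
  have inj\<sigma>: "inj \<sigma>" using perm by (rule permutes_inj)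
  have nb: "neighbours E V (\<sigma> v) = \<sigma> ` neighbours E V v" if "v \<in> V" for v
  proof -
    have "neighbours E V (\<sigma> v) = {u \<in> \<sigma> ` V. (\<sigma> v, u) \<in> E}" using img by (simp add: neighbours_def)
    also have "\<dots> = \<sigma> ` neighbours E V v" using edge that by (auto simp: neighbours_def)
    finally show ?thesis .
  qed
  have leaf_iff: "\<sigma> v \<in> leaves E V \<longleftrightarrow> v \<in> leaves E V" for v
  proof (cases "v \<in> V")
    case True
    then show ?thesis
      using nb V_iff card_image[OF inj_on_subset[OF inj\<sigma> subset_UNIV]] by (simp add: leaves_def)
  next
    case False
    then show ?thesis using V_iff leaves_subset by blast
  qed
  have pend_img: "pend (\<sigma> v) = \<sigma> ` pend v" if "v \<in> V" for v
    using nb[OF that] leaf_iff by (auto simp: pendants_def)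
  \<comment> \<open>The restriction of \<open>\<sigma>\<close> to the core, made the identity
    elsewhere as \<open>permutes\<close> demands.\<close>
  define \<rho> where "\<rho> x = (if x \<in> core then \<sigma> x else x)" for x
  have "\<sigma> ` core = core"
  proof -
    have "finite (leaves E V)" using finite_V leaves_subset by (rule rev_finite_subset)
    then have "\<sigma> ` leaves E V = leaves E V"
      using inj\<sigma> leaf_iff by (intro endo_inj_surj) (auto intro: inj_on_subset)
    then show ?thesis using img by (simp add: image_set_diff[OF inj\<sigma>])
  qed
  then have "bij_betw \<sigma> core core"
    using inj_on_subset[OF inj\<sigma>] by (simp add: bij_betw_def)
  then have "bij_betw \<rho> core core"
    by (rule bij_betw_cong[THEN iffD1, rotated]) (simp add: \<rho>_def)
  then have perm\<rho>: "\<rho> permutes core" by (rule bij_imp_permutes) (auto simp: \<rho>_def)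
  have "(\<rho> u, \<rho> v) \<in> E \<longleftrightarrow> (u, v) \<in> E" if "u \<in> core" "v \<in> core" for u v
    using that edge by (simp add: \<rho>_def)
  moreover have "absorbed_coloring E V \<phi> (\<rho> v) = absorbed_coloring E V \<phi> v" if "v \<in> core" for v
  proof -
    have "\<phi> ` \<sigma> ` pend v = \<phi> ` pend v"
      unfolding image_image using col pend_subset by (intro image_cong) auto
    then show ?thesis using that col pend_img by (simp add: \<rho>_def absorbed_coloring_def)
  qed
  ultimately have "\<rho> = id" using dist perm\<rho> unfolding distinguishing_graph_on by blast
  then have fixed: "\<sigma> v = v" if "v \<in> core" for v
    using that \<rho>_def[of v] by simp
  show "\<sigma> = id"
  proof
    fix x
    consider "x \<in> core" | "x \<in> leaves E V" | "x \<notin> V" by blast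
    then show "\<sigma> x = id x"
    proof cases
      case 1
      then show ?thesis using fixed by simp
    next
      case 2
      let ?p = "parent x"
      have p: "?p \<in> core" using parent(1)[OF 2] .
      have x: "x \<in> pend ?p" using 2 p pend_iff by auto
      then have "\<sigma> x \<in> pend ?p" using pend_img[of ?p] fixed[OF p] p by auto
      moreover have "\<phi> (\<sigma> x) = \<phi> x" using col 2 leaves_subset by blast
      ultimately show ?thesis using inj_onD[OF inj[OF p]] x by simp
    next
      case 3
      then show ?thesis using permutes_not_in[OF perm] by simp
    qed
  qed
qed

section \<open>Lists of records\<close>

definition absorbed_lists :: "('a \<Rightarrow> nat set) \<Rightarrow> 'a \<Rightarrow> nat set" where
  "absorbed_lists L v = (\<lambda>(c, X). code c X) ` (L v \<times> transversals (pend v) L)"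

lemma absorbed_listsE:
  assumes "y \<in> absorbed_lists L v"
  obtains c f where "y = code c (f ` pend v)" "c \<in> L v" "inj_on f (pend v)" "\<forall>u\<in>pend v. f u \<in> L u"
  using assms unfolding absorbed_lists_def by (auto elim!: transversalsE)

lemma card_absorbed_lists:
  "card (absorbed_lists L v) = card (L v) * card (transversals (pend v) L)"
proof -
  have "inj_on (\<lambda>(c, X). code c X) (L v \<times> transversals (pend v) L)"
  proof (rule inj_onI, clarify)
    fix c d X Y
    assume "X \<in> transversals (pend v) L" "Y \<in> transversals (pend v) L" "code c X = code d Y"
    then show "c = d \<and> X = Y" using code_inject finite_transversal[OF finite_pend] by metis
  qed
  then show ?thesis by (simp add: absorbed_lists_def card_image card_cartesian_product)
qed

lemma absorbed_coloring_in_lists: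
  assumes "distinguishing (graph_on V E) \<phi>" "\<forall>v\<in>V. \<phi> v \<in> L v" "v \<in> core"
  shows "absorbed_coloring E V \<phi> v \<in> absorbed_lists L v"
proof -
  have "\<phi> ` pend v \<in> transversals (pend v) L"
    using inj_on_pend_if_distinguishing[OF assms(1,3)] assms(2) pend_subset[of v]
    by (intro transversalsI) auto
  then show ?thesis using assms by (auto simp: absorbed_lists_def absorbed_coloring_def)
qed

text \<open>A common record consists of a color in both \<open>F v\<close> and \<open>F w\<close>
  and a color set chosen at both sets of pendants. Matching pendants of equal color gives
  \<open>h\<close>. By uniformity a shared color, whether in \<open>K\<close> or in
  \<open>L\<close>, forces equal lists of \<open>K\<close>.\<close>

lemma absorbed_lists_meet:
  assumes u: "uniform_lists V K L" and v: "v \<in> core" "w \<in> core"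
    and F: "F = K \<or> F = L" and meet: "absorbed_lists F v \<inter> absorbed_lists F w \<noteq> {}"
  shows "K v = K w \<and> (\<exists>h. bij_betw h (pend v) (pend w) \<and> (\<forall>x\<in>pend v. K (h x) = K x))"
proof -
  have same: "K x = K y" if "c \<in> F x" "c \<in> F y" "x \<in> V" "y \<in> V" for c x y
    using u that F unfolding uniform_lists_def by blast
  obtain y where y: "y \<in> absorbed_lists F v" "y \<in> absorbed_lists F w" using meet by blast
  obtain c f where f: "y = code c (f ` pend v)" "c \<in> F v" "inj_on f (pend v)" "\<forall>u\<in>pend v. f u \<in> F u"
    using y(1) by (rule absorbed_listsE)
  obtain d g where g: "y = code d (g ` pend w)" "d \<in> F w" "inj_on g (pend w)" "\<forall>u\<in>pend w. g u \<in> F u"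
    using y(2) by (rule absorbed_listsE)
  have eq: "c = d" "f ` pend v = g ` pend w"
    using f(1) g(1) finite_pend by (auto simp: code_inject)
  have f_bij: "bij_betw f (pend v) (f ` pend v)" using f(3) by (simp add: bij_betw_def)
  have g_bij: "bij_betw g (pend w) (f ` pend v)" using g(3) eq by (simp add: bij_betw_def)
  define h where "h = inv_into (pend w) g \<circ> f"
  have h: "bij_betw h (pend v) (pend w)"
    unfolding h_def using bij_betw_trans[OF f_bij bij_betw_inv_into[OF g_bij]] .
  have "K (h x) = K x" if x: "x \<in> pend v" for x
  proof -
    have "h x \<in> pend w" using h x by (rule bij_betw_apply)
    moreover have "g (h x) = f x"
    proof -
      have "f x \<in> g ` pend w" using x eq(2) by blast
      then show ?thesis by (simp add: h_def f_inv_into_f)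
    qed
    ultimately show ?thesis using same[of "f x"] f(4) g(4) x pend_subset by (metis subsetD)
  qed
  then show ?thesis using h same f(2) g(2) eq(1) v by blast
qed

text \<open>A choice \<open>g\<close> at the pendants of \<open>w\<close> is transported to
  \<open>g \<circ> h\<close> at those of \<open>v\<close>, with the same color set.\<close>

lemma absorbed_lists_subset:
  assumes "K v = K w" "bij_betw h (pend v) (pend w)" "\<forall>x\<in>pend v. K (h x) = K x"
  shows "absorbed_lists K w \<subseteq> absorbed_lists K v"
proof
  fix y assume "y \<in> absorbed_lists K w"
  then obtain c g where g: "y = code c (g ` pend w)" "c \<in> K w" "inj_on g (pend w)"
    "\<forall>u\<in>pend w. g u \<in> K u" by (rule absorbed_listsE)
  have img: "h ` pend v = pend w" and injh: "inj_on h (pend v)"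
    using assms(2) by (auto simp: bij_betw_def)
  have "(g \<circ> h) ` pend v \<in> transversals (pend v) K"
    using g(3,4) img injh assms(3) by (intro transversalsI comp_inj_on) auto
  moreover have "(g \<circ> h) ` pend v = g ` pend w" using img by (metis image_comp)
  ultimately show "y \<in> absorbed_lists K v" using g(1,2) assms(1) by (auto simp: absorbed_lists_def)
qed

text \<open>Sizes are compared factor by factor: own colors by hypothesis, color sets of pendants by
  counting transversals. Any overlap of record lists, on either side, yields a matching of pendants
  that makes the record lists of \<open>K\<close> equal.\<close>

lemma uniform_lists_absorbed:
  assumes u: "uniform_lists V K L"
  shows "uniform_lists core (absorbed_lists K) (absorbed_lists L)"
  unfolding uniform_lists_def
proof (intro conjI ballI)
  fix v assume v: "v \<in> core"
  have fin: "finite (K x)" "finite (L x)" "card (K x) \<le> card (L x)" if "x \<in> V" for x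
    using u that unfolding uniform_lists_def by auto
  show "finite (absorbed_lists K v)" "finite (absorbed_lists L v)"
    using fin v finite_pend pend_subset[of v] unfolding absorbed_lists_def
    by (auto intro!: finite_imageI finite_cartesian_product finite_transversals)
  show "card (absorbed_lists K v) \<le> card (absorbed_lists L v)"
    unfolding card_absorbed_lists
    using fin v card_transversals_le[OF finite_pend uniform_lists_subset[OF u pend_subset]]
    by (intro mult_mono) auto
next
  fix v w assume v: "v \<in> core" "w \<in> core"
  show "absorbed_lists K v = absorbed_lists K w \<or>
    absorbed_lists K v \<inter> absorbed_lists K w = {} \<and> absorbed_lists L v \<inter> absorbed_lists L w = {}"
  proof (rule disjCI)
    assume "\<not> (absorbed_lists K v \<inter> absorbed_lists K w = {} \<and>
      absorbed_lists L v \<inter> absorbed_lists L w = {})"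
    then obtain F where F: "F = K \<or> F = L" "absorbed_lists F v \<inter> absorbed_lists F w \<noteq> {}" by blast
    \<comment> \<open>Each of the two inclusions requires a matching in its own direction.\<close>
    then have "absorbed_lists F w \<inter> absorbed_lists F v \<noteq> {}" by blast
    with F absorbed_lists_meet[OF u v F(1)] absorbed_lists_meet[OF u v(2,1) F(1)]
    show "absorbed_lists K v = absorbed_lists K w"
      by (intro equalityI) (metis absorbed_lists_subset)+
  qed
qed

text \<open>Decoding the record at each core vertex gives its own color and distinct colors for its
  leaves; every leaf has one parent, so these choices combine to a coloring whose records are
  \<open>f'\<close>.\<close>

lemma lift_from_absorbed:
  assumes dist: "distinguishing (graph_on core E) f'" and f': "\<forall>v\<in>core. f' v \<in> absorbed_lists L v"
  shows "\<exists>f. distinguishing (graph_on V E) f \<and> (\<forall>v\<in>V. f v \<in> L v)"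
proof -
  have "\<exists>c g. f' v = code c (g ` pend v) \<and> c \<in> L v \<and> inj_on g (pend v) \<and> (\<forall>u\<in>pend v. g u \<in> L u)"
    if "v \<in> core" for v
    using absorbed_listsE[of "f' v" L v] f' that by metis
  then obtain c g where cg: "f' v = code (c v) (g v ` pend v)" "c v \<in> L v" "inj_on (g v) (pend v)"
      "\<forall>u\<in>pend v. g v u \<in> L u" if "v \<in> core" for v
    by metis
  define f where "f x = (if x \<in> leaves E V then g (parent x) x else c x)" for x
  have f_pend: "f u = g v u" if "u \<in> pend v" "v \<in> core" for u v
    using that pend_iff[of v u] by (auto simp: f_def)
  have f_core: "f v = c v" if "v \<in> core" for v using that by (simp add: f_def)
  have "absorbed_coloring E V f v = f' v" if v: "v \<in> core" for v
  proof -
    have "f ` pend v = g v ` pend v" using f_pend v by (intro image_cong) auto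
    then show ?thesis using cg(1)[OF v] f_core[OF v] by (simp add: absorbed_coloring_def)
  qed
  then have "distinguishing (graph_on core E) (absorbed_coloring E V f)"
    using dist distinguishing_cong by metis
  moreover have "inj_on f (pend v)" if v: "v \<in> core" for v
    using cg(3)[OF v] f_pend v by (simp cong: inj_on_cong)
  ultimately have "distinguishing (graph_on V E) f" by (rule distinguishing_if_absorbed)
  moreover have "f v \<in> L v" if "v \<in> V" for v
  proof (cases "v \<in> leaves E V")
    case True
    then have "v \<in> pend (parent v)" "parent v \<in> core" using parent(1)[OF True] pend_iff by auto
    then show ?thesis using cg(4) f_pend by metis
  next
    case False
    then show ?thesis using that cg(2) f_core by simp
  qed
  ultimately show ?thesis by blast
qed

end

section \<open>Trees\<close>

text \<open>Connectedness in terms of cuts, a form that passes to the core without any handling of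
  walks.\<close>

definition cut_connected :: "'a rel \<Rightarrow> 'a set \<Rightarrow> bool" where
  "cut_connected E V \<longleftrightarrow>
     (\<forall>S. S \<subseteq> V \<longrightarrow> S \<noteq> {} \<longrightarrow> S \<noteq> V \<longrightarrow> (\<exists>u\<in>S. \<exists>w\<in>V - S. (u, w) \<in> E))"

text \<open>For finite simple graphs this characterizes forests; it is inherited by subsets of
  \<open>V\<close> at once.\<close>

definition degenerate1 :: "'a rel \<Rightarrow> 'a set \<Rightarrow> bool" where
  "degenerate1 E V \<longleftrightarrow> (\<forall>S. S \<subseteq> V \<longrightarrow> S \<noteq> {} \<longrightarrow> (\<exists>v\<in>S. card (neighbours E S v) \<le> 1))"

lemma cut_connectedE:
  assumes "cut_connected E V" "S \<subseteq> V" "S \<noteq> {}" "S \<noteq> V"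
  obtains u w where "u \<in> S" "w \<in> V - S" "(u, w) \<in> E"
  using assms unfolding cut_connected_def by blast

text \<open>Two adjacent leaves have no further neighbours, so no arc would lead from them to a
  third vertex.\<close>

lemma leafy_graph_if_tree:
  assumes fin: "finite V" and sym: "sym E" and irrefl: "irrefl E"
    and conn: "cut_connected E V" and card: "3 \<le> card V"
  shows "leafy_graph V E"
proof
  fix u assume u: "u \<in> leaves E V"
  then obtain p where p: "neighbours E V u = {p}"
    unfolding leaves_def by (auto simp: card_1_singleton_iff)
  then have pV: "p \<in> V" "(u, p) \<in> E" by (auto simp: neighbours_def)
  have "p \<notin> leaves E V"
  proof
    assume "p \<in> leaves E V"
    then obtain q where q: "neighbours E V p = {q}"
      unfolding leaves_def by (auto simp: card_1_singleton_iff)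
    have uV: "u \<in> V" using u by (simp add: leaves_def)
    then have "u \<in> neighbours E V p" using pV sym by (auto simp: neighbours_def dest: symD)
    then have "q = u" using q by simp
    have "card {u, p} \<le> 2" by (simp add: card_insert_if)
    then have "{u, p} \<noteq> V" using card by auto
    then obtain a b where "a \<in> {u, p}" "b \<in> V - {u, p}" "(a, b) \<in> E"
      using conn uV pV(1) by (elim cut_connectedE[of E V "{u, p}"]) auto
    then have "b \<in> neighbours E V u \<or> b \<in> neighbours E V p" by (auto simp: neighbours_def)
    then show False using p q \<open>q = u\<close> \<open>b \<in> V - {u, p}\<close> by auto
  qed
  then show "\<exists>p\<in>V - leaves E V. neighbours E V u = {p}" using p pV by blast
qed (use assms in auto)

text \<open>Adding to \<open>S\<close> the leaves hanging at it gives a cut of \<open>V\<close> that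
  no arc at a leaf crosses; the crossing arc therefore lies in the core.\<close>

lemma (in leafy_graph) cut_connected_core:
  assumes "cut_connected E V"
  shows "cut_connected E core"
  unfolding cut_connected_def
proof (intro allI impI)
  fix S assume S: "S \<subseteq> core" "S \<noteq> {}" "S \<noteq> core"
  define S' where "S' = S \<union> {u \<in> leaves E V. parent u \<in> S}"
  have S'_core: "v \<in> S' \<longleftrightarrow> v \<in> S" if "v \<in> core" for v using that by (auto simp: S'_def)
  have S'_leaf: "v \<in> S' \<longleftrightarrow> parent v \<in> S'" if "v \<in> leaves E V" for v
    using that S(1) S'_core[OF parent(1)[OF that]] by (auto simp: S'_def)
  have "S' \<noteq> V" using S S'_core by blast
  moreover have "S' \<subseteq> V" "S' \<noteq> {}" using S leaves_subset by (auto simp: S'_def)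
  ultimately obtain u w where uw: "u \<in> S'" "w \<in> V - S'" "(u, w) \<in> E"
    using assms by (elim cut_connectedE) auto
  have uV: "u \<in> V" using uw(1) \<open>S' \<subseteq> V\<close> by blast
  have "u \<notin> leaves E V"
    using S'_leaf[of u] edge_leaf_iff[of u w] uw by auto
  moreover have "w \<notin> leaves E V"
    using S'_leaf[of w] edge_leaf_iff[of w u] uw uV edge_commute[of u w] by auto
  ultimately have "u \<in> S" "w \<in> core - S" using uw uV S'_core by auto
  then show "\<exists>u\<in>S. \<exists>w\<in>core - S. (u, w) \<in> E" using uw by blast
qed

text \<open>Degeneracy provides a vertex of degree at most 1, and connectedness with a second vertex
  excludes degree 0.\<close>

lemma exists_leaf:
  assumes conn: "cut_connected E V" and deg: "degenerate1 E V"
    and fin: "finite V" and card: "2 \<le> card V"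
  shows "leaves E V \<noteq> {}"
proof -
  have "V \<noteq> {}" using card by auto
  then obtain v where v: "v \<in> V" "card (neighbours E V v) \<le> 1"
    using deg unfolding degenerate1_def by blast
  have "{v} \<noteq> V" using card by auto
  then obtain w where "w \<in> V" "(v, w) \<in> E" using conn v by (elim cut_connectedE[of E V "{v}"]) auto
  then have "neighbours E V v \<noteq> {}" by (auto simp: neighbours_def)
  moreover have "finite (neighbours E V v)" using fin by (simp add: neighbours_def)
  ultimately have "card (neighbours E V v) = 1" using v(2) by (metis card_0_eq le_eq_less_or_eq less_one)
  then show ?thesis using v(1) by (auto simp: leaves_def)
qed

lemma inj_on_if_distinguishing_small:
  assumes "distinguishing (graph_on V E) \<phi>" "sym E" "irrefl E" "finite V" "card V \<le> 2"
  shows "inj_on \<phi> V"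
proof (rule inj_onI)
  fix a b assume ab: "a \<in> V" "b \<in> V" "\<phi> a = \<phi> b"
  show "a = b"
  proof (rule ccontr)
    assume "a \<noteq> b"
    then have "V = {a, b}" using ab assms(4,5) by (intro card_seteq[symmetric]) auto
    then show False
      using \<open>a \<noteq> b\<close> ab distinguishing_transpose[OF assms(1-3) ab] by auto
  qed
qed

lemma list_coloring_from_uniform_coloring:
  assumes "finite V" "sym E" "irrefl E" "cut_connected E V" "degenerate1 E V"
    and "uniform_lists V K L" "distinguishing (graph_on V E) \<phi>" "\<forall>v\<in>V. \<phi> v \<in> K v"
  shows "\<exists>f. distinguishing (graph_on V E) f \<and> (\<forall>v\<in>V. f v \<in> L v)"
  using assms
proof (induction "card V" arbitrary: V K L \<phi> rule: less_induct)
  case less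
  show ?case
  proof (cases "card V \<le> 2")
    case True
    then have "inj_on \<phi> V" using inj_on_if_distinguishing_small less.prems by blast
    \<comment> \<open>The injective \<open>\<phi>\<close> yields a transversal of \<open>K\<close>
      on all of \<open>V\<close>; by counting, \<open>L\<close> has one too, that is, an injective
      coloring.\<close>
    then have "transversals V K \<noteq> {}" using transversalsI less.prems(8) by blast
    moreover have "finite (transversals V K)"
      using less.prems by (intro finite_transversals) (auto simp: uniform_lists_def)
    ultimately have "0 < card (transversals V L)"
      using card_transversals_le[OF less.prems(1,6)] by (metis card_gt_0_iff less_le_trans)
    then obtain X where "X \<in> transversals V L" by (metis card.empty ex_in_conv less_irrefl)
    then obtain f where f: "inj_on f V" "\<forall>v\<in>V. f v \<in> L v" by (rule transversalsE)
    then show ?thesis using inj_on_imp_distinguishing[of f "graph_on V E"] by auto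
  next
    case False
    then interpret leafy_graph V E
      using less.prems by (intro leafy_graph_if_tree) auto
    have "leaves E V \<noteq> {}" using exists_leaf less.prems False by (metis linear)
    then have "core \<subset> V" using leaves_subset by blast
    then have smaller: "card core < card V" using finite_V by (rule psubset_card_mono[rotated])
    have "degenerate1 E core" using less.prems(5) unfolding degenerate1_def by blast
    \<comment> \<open>The induction hypothesis is used for the core, the record lists of
      \<open>K\<close> and \<open>L\<close>, and the coloring by the records of
      \<open>\<phi>\<close>.\<close>
    then have "\<exists>f'. distinguishing (graph_on core E) f' \<and> (\<forall>v\<in>core. f' v \<in> absorbed_lists L v)"
      using less.prems finite_V absorbed_coloring_in_lists
      by (intro less.hyps[OF smaller _ _ _ cut_connected_core _ uniform_lists_absorbed
            distinguishing_absorbed]) auto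
    then show ?thesis using lift_from_absorbed by blast
  qed
qed

section \<open>From walks and cycles to cuts and degeneracy\<close>

lemma cut_connected_if_undirected_tree:
  assumes "undirected_tree T"
  shows "cut_connected (parcs T) (pverts T)"
  unfolding cut_connected_def
proof (intro allI impI)
  interpret pair_graph T using assms by (simp add: undirected_tree_def)
  fix S assume S: "S \<subseteq> pverts T" "S \<noteq> {}" "S \<noteq> pverts T"
  obtain u w where u: "u \<in> S" and w: "w \<in> pverts T" "w \<notin> S" using S by blast
  have arcs: "(x, y) \<in> parcs T" if "(x, y) \<in> parcs (mk_symmetric T)" for x y
    using that arcs_symmetric by (auto simp: parcs_mk_symmetric)
  have "(u, w) \<in> rtrancl_on (pverts T) (parcs (mk_symmetric T))"
    using assms u w S(1) unfolding undirected_tree_def connected_def strongly_connected_def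
    by (auto simp: reachable_def)
  \<comment> \<open>A path from \<open>u\<close> to a vertex outside \<open>S\<close> has a first
    arc leaving \<open>S\<close>; the implication makes the start in \<open>S\<close>
    trivial.\<close>
  then have "w \<notin> S \<longrightarrow> (\<exists>u\<in>S. \<exists>w\<in>pverts T - S. (u, w) \<in> parcs T)"
    by (induction rule: rtrancl_on_induct) (use u arcs in auto)
  then show "\<exists>u\<in>S. \<exists>w\<in>pverts T - S. (u, w) \<in> parcs T" using w by blast
qed

text \<open>Walks are lists of arcs; zipping a vertex list with its tail lets the cycle below be
  found as a list of vertices.\<close>

lemma awalk_of_vertices:
  assumes "successively (\<lambda>x y. (x, y) \<in> parcs G) (u # ws)"
  shows "pcas u (zip (u # ws) ws) (last (u # ws)) \<and> set (zip (u # ws) ws) \<subseteq> parcs G \<and>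
    pawalk_verts u (zip (u # ws) ws) = u # ws"
  using assms by (induction ws arbitrary: u) auto

text \<open>If all degrees within \<open>S\<close> were at least 2, the first vertex
  \<open>x\<close> of a longest path would have all its neighbours on the path, and one other than
  its successor would close a cycle of length at least 3.\<close>

lemma degenerate1_if_undirected_tree:
  assumes "undirected_tree T"
  shows "degenerate1 (parcs T) (pverts T)"
  unfolding degenerate1_def
proof (intro allI impI, rule ccontr)
  interpret pair_graph T using assms by (simp add: undirected_tree_def)
  fix S assume S: "S \<subseteq> pverts T" "S \<noteq> {}"
    and "\<not> (\<exists>v\<in>S. card (neighbours (parcs T) S v) \<le> 1)"
  then have deg: "2 \<le> card (neighbours (parcs T) S v)" if "v \<in> S" for v using that by force
  have finS: "finite S" using finite_subset[OF S(1)] by simp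
  define path where "path vs \<longleftrightarrow> vs \<noteq> [] \<and> distinct vs \<and> set vs \<subseteq> S \<and>
    successively (\<lambda>x y. (x, y) \<in> parcs T) vs" for vs
  obtain s where "s \<in> S" using S(2) by blast
  then have "path [s]" by (simp add: path_def)
  moreover have "\<forall>vs. path vs \<longrightarrow> length vs < Suc (card S)"
    using finS by (auto simp: path_def less_Suc_eq_le distinct_card[symmetric] intro: card_mono)
  ultimately obtain vs where vs: "path vs" "\<And>ws. path ws \<Longrightarrow> length ws \<le> length vs"
    using ex_has_greatest_nat[of path "[s]" length] by blast
  obtain x xs where x: "vs = x # xs" using vs(1) by (cases vs) (auto simp: path_def)
  have nb: "y \<in> set xs" if "y \<in> neighbours (parcs T) S x" for y
  proof (rule ccontr)
    assume "y \<notin> set xs"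
    have y: "y \<in> S" "(x, y) \<in> parcs T" "(y, x) \<in> parcs T"
      using that arcs_symmetric by (auto simp: neighbours_def)
    then have "path (y # vs)"
      using vs(1) \<open>y \<notin> set xs\<close> no_loops' by (auto simp: path_def x)
    then show False using vs(2) by force
  qed
  have "x \<in> S" using vs(1) by (simp add: path_def x)
  \<comment> \<open>If \<open>xs\<close> is empty, \<open>hd xs\<close> is unspecified, but two
    neighbours cannot fit into any singleton; \<open>nb\<close> then shows that \<open>xs\<close> is
    nonempty.\<close>
  have "\<not> neighbours (parcs T) S x \<subseteq> {hd xs}"
    using deg[OF \<open>x \<in> S\<close>] card_mono[of "{hd xs}" "neighbours (parcs T) S x"] by auto
  then obtain y where y: "y \<in> neighbours (parcs T) S x" "y \<noteq> hd xs" by blast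
  obtain h zs where xs: "xs = h # zs" using nb[OF y(1)] by (cases xs) auto
  then have "y \<in> set zs" using nb[OF y(1)] y(2) by auto
  then obtain as bs where zs: "zs = as @ y # bs" by (auto simp: in_set_conv_decomp)
  \<comment> \<open>The closed walk is \<open>x # ?ws\<close>. Its start is repeated at the end of
    \<open>?ws\<close>, whose entries are the vertices that must be distinct.\<close>
  let ?ws = "h # as @ [y, x]"
  have yx: "(y, x) \<in> parcs T" using y(1) arcs_symmetric by (auto simp: neighbours_def)
  have suc: "successively (\<lambda>x y. (x, y) \<in> parcs T) (x # ?ws)"
    using vs(1) yx by (auto simp: path_def x xs zs successively_append_iff successively_Cons hd_append)
  have dist: "distinct ?ws" using vs(1) by (auto simp: path_def x xs zs)
  let ?p = "zip (x # ?ws) ?ws"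
  have "pre_digraph.cycle (with_proj T) ?p"
    unfolding cycle_def
  proof (intro exI conjI)
    show "awalk x ?p x"
      using awalk_of_vertices[OF suc] S(1) \<open>x \<in> S\<close> unfolding awalk_def by auto
    show "distinct (tl (pawalk_verts x ?p))"
      using awalk_of_vertices[OF suc] dist by simp
  qed simp
  moreover have "3 \<le> length ?p" by simp
  ultimately show False using assms unfolding undirected_tree_def by blast
qed

theorem theorem1:
  fixes T :: "'a pair_pre_digraph"
  assumes "undirected_tree T"
  shows "distinguishing_number T = list_distinguishing_number T"
proof (rule antisym)
  interpret pair_graph T using assms by (simp add: undirected_tree_def)
  have T: "graph_on (pverts T) (parcs T) = T" by simp
  have fin: "finite (pverts T)" by simp
  have sym: "sym (parcs T)" using arcs_symmetric by (auto intro: symI)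
  have irrefl: "irrefl (parcs T)" using no_loops' by (auto simp: irrefl_def)
  show "distinguishing_number T \<le> list_distinguishing_number T"
  proof -
    let ?k = "list_distinguishing_number T"
    have "list_distinguishable T (\<lambda>_. {1..?k})"
      using fin by (intro list_distinguishing_number_attained) auto
    then have "\<exists>\<phi>. k_coloring T ?k \<phi> \<and> distinguishing T \<phi>"
      unfolding list_distinguishable_def k_coloring_def by blast
    then show ?thesis unfolding distinguishing_number_def by (rule Least_le)
  qed
  show "list_distinguishing_number T \<le> distinguishing_number T"
    unfolding list_distinguishing_number_def
  proof (rule Least_le, intro allI impI)
    let ?k = "distinguishing_number T"
    fix L :: "'a \<Rightarrow> nat set" assume L: "\<forall>v\<in>pverts T. finite (L v) \<and> card (L v) = ?k"
    obtain \<phi> where \<phi>: "k_coloring T ?k \<phi>" "distinguishing T \<phi>"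
      using distinguishing_number_attained[OF fin] by blast
    \<comment> \<open>All lists on the \<open>K\<close> side coincide, so no disjointness is
      demanded of \<open>L\<close>.\<close>
    have "uniform_lists (pverts T) (\<lambda>_. {1..?k}) L"
      using L by (auto simp: uniform_lists_def)
    then have "\<exists>f. distinguishing (graph_on (pverts T) (parcs T)) f \<and> (\<forall>v\<in>pverts T. f v \<in> L v)"
      using \<phi> cut_connected_if_undirected_tree[OF assms] degenerate1_if_undirected_tree[OF assms]
      by (intro list_coloring_from_uniform_coloring[OF fin sym irrefl]) (auto simp: k_coloring_def T)
    then show "list_distinguishable T L" unfolding list_distinguishable_def T .
  qed
qed

end
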